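(* There is $n_0$ such that for every $n\geq n_0$, every real $0<\varepsilon<1/2$, and every properly edge-coloured $n$-vertex graph $G$ with at least $\frac{4}{\varepsilon}n\log n$ edges, there exist an integer $k$ and a cycle of length $k$ in $G$ whose edges use more than $(1-\varepsilon)k$ distinct colours.
   Context: $\log$ denotes the natural logarithm. An edge-colouring is proper if any two edges sharing a vertex receive different colours. A cycle means a genuine cycle (distinct vertices). *)

theory Defs
  imports Complex_Main
begin

definition finite_simple_graph :: "'a set \<Rightarrow> 'a set set \<Rightarrow> bool" where
  "finite_simple_graph V E \<longleftrightarrow> finite V \<and> (\<forall>e\<in>E. e \<subseteq> V \<and> card e = 2)"

definition proper_edge_colouring :: "'a set set \<Rightarrow> ('a set \<Rightarrow> 'c) \<Rightarrow> bool" where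
  "proper_edge_colouring E col \<longleftrightarrow>
     (\<forall>e\<in>E. \<forall>f\<in>E. e \<noteq> f \<and> e \<inter> f \<noteq> {} \<longrightarrow> col e \<noteq> col f)"

text \<open>A cycle is given by the list of its vertices in cyclic order; the closing edge joins the
  last vertex to the first. Its length is the length of the list.\<close>

definition cycle_edges :: "'a list \<Rightarrow> 'a set set" where
  "cycle_edges p = {{p ! i, p ! (Suc i mod length p)} | i. i < length p}"

definition is_cycle :: "'a set \<Rightarrow> 'a set set \<Rightarrow> 'a list \<Rightarrow> bool" where
  "is_cycle V E p \<longleftrightarrow>
     3 \<le> length p \<and> distinct p \<and> set p \<subseteq> V \<and> cycle_edges p \<subseteq> E"

end

theory Submission imports Defs "HOL-Analysis.Harmonic_Numbers" begin

text \<open>Passing to a densest subgraph and growing a ball in it until it stops doubling gives a set of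
  radius at most \<open>log\<^sub>2 n + 1\<close> that spans a subgraph of average degree at least \<open>4/\<epsilon> log n\<close>. By the
  pedestrian argument of Graham and Kleitman this subgraph contains a rainbow walk longer than
  \<open>4/\<epsilon> log n\<close>, and returning from its end to its start through the centre of the ball costs fewer
  than an \<open>\<epsilon>\<close>-fraction of its length. Splitting the resulting closed walk at repeated vertices, one
  of the pieces still has more than \<open>1 - \<epsilon>\<close> times its length many colours; as \<open>\<epsilon> < 1/2\<close>, it is not
  an edge traversed back and forth, so it is a cycle.\<close>

section \<open>Walks and their edge lists\<close>

text \<open>The edges are kept as a list, in order and with repetition, so that the length counts
  steps and a rainbow walk is one with \<open>distinct (map col (walk_edges xs))\<close>.\<close>

fun walk_edges :: "'a list \<Rightarrow> 'a set list" where
  "walk_edges [] = []"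
| "walk_edges [x] = []"
| "walk_edges (x # y # zs) = {x, y} # walk_edges (y # zs)"

lemma walk_edges_append:
  "walk_edges (xs @ y # ys) = walk_edges (xs @ [y]) @ walk_edges (y # ys)"
  by (induction xs rule: walk_edges.induct) auto

lemma length_walk_edges [simp]: "length (walk_edges xs) = length xs - 1"
  by (induction xs rule: walk_edges.induct) auto

lemma walk_edges_nth: "Suc i < length xs \<Longrightarrow> walk_edges xs ! i = {xs ! i, xs ! Suc i}"
  by (induction xs arbitrary: i rule: walk_edges.induct) (auto simp: nth_Cons split: nat.split)

lemma set_walk_edges: "set (walk_edges xs) = {{xs ! i, xs ! Suc i} | i. Suc i < length xs}"
proof -
  have "set (walk_edges xs) = (!) (walk_edges xs) ` {i. Suc i < length xs}"
    by (auto simp: set_conv_nth less_diff_conv)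
  also have "\<dots> = (\<lambda>i. {xs ! i, xs ! Suc i}) ` {i. Suc i < length xs}"
    by (intro image_cong) (simp_all add: walk_edges_nth)
  finally show ?thesis by blast
qed

lemma set_walk_edges_rev: "set (walk_edges (rev xs)) = set (walk_edges xs)"
proof (induction xs rule: walk_edges.induct)
  case (3 x y zs)
  have "walk_edges (rev (x # y # zs)) = walk_edges (rev zs @ [y]) @ walk_edges [y, x]"
    using walk_edges_append[of "rev zs" y "[x]"] by simp
  with 3 show ?case by (auto simp: insert_commute)
qed auto

text \<open>Starting at \<open>last p\<close> makes the closing edge the first step. Closed walks
  are accordingly written \<open>h # p\<close> with \<open>last p = h\<close>, so that
  \<open>length p\<close> is their number of steps.\<close>

lemma cycle_edges_eq_walk_edges:
  assumes "p \<noteq> []"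
  shows "cycle_edges p = set (walk_edges (last p # p))"
proof (intro equalityI subsetI)
  let ?w = "last p # p"
  fix e assume "e \<in> cycle_edges p"
  then obtain i where i: "i < length p" "e = {p ! i, p ! (Suc i mod length p)}"
    by (auto simp: cycle_edges_def)
  show "e \<in> set (walk_edges ?w)"
  proof (cases "Suc i = length p")
    case True
    then have "p ! i = last p" using assms by (metis diff_Suc_1 last_conv_nth)
    then have "e = {?w ! 0, ?w ! Suc 0}" using i True by simp
    moreover have "Suc 0 < length ?w" using assms by simp
    ultimately show ?thesis unfolding set_walk_edges by blast
  next
    case False
    then have "e = {?w ! Suc i, ?w ! Suc (Suc i)}" using i by auto
    moreover have "Suc (Suc i) < length ?w" using i False by simp
    ultimately show ?thesis unfolding set_walk_edges by blast
  qed
next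
  let ?w = "last p # p"
  fix e assume "e \<in> set (walk_edges ?w)"
  then obtain i where i: "i < length p" "e = {?w ! i, ?w ! Suc i}"
    unfolding set_walk_edges by auto
  show "e \<in> cycle_edges p"
  proof (cases i)
    case 0
    then have "e = {p ! (length p - 1), p ! (Suc (length p - 1) mod length p)}"
      using i assms by (simp add: last_conv_nth)
    moreover have "length p - 1 < length p" using assms by simp
    ultimately show ?thesis unfolding cycle_edges_def by blast
  next
    case (Suc j)
    then have "e = {p ! j, p ! (Suc j mod length p)}" "j < length p" using i by auto
    then show ?thesis unfolding cycle_edges_def by blast
  qed
qed

section \<open>From closed walks to cycles\<close>

text \<open>Strong induction on the length. A repeated vertex cuts the closed walk into two shorter
  ones; their lengths add up and their numbers of colours are subadditive, so one of them inherits
  the ratio above 1 - \<epsilon>.\<close>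

lemma colourful_closed_walk_imp_cycle:
  fixes \<epsilon> :: real
  assumes "\<epsilon> \<le> 1/2" and "\<forall>e\<in>E. e \<subseteq> V \<and> card e = 2"
    and "last p = h" "p \<noteq> []" "set (walk_edges (h # p)) \<subseteq> E"
    and "card (col ` set (walk_edges (h # p))) > (1 - \<epsilon>) * length p"
  shows "\<exists>q. is_cycle V E q \<and> card (col ` cycle_edges q) > (1 - \<epsilon>) * length q"
  using assms(3-)
proof (induction "length p" arbitrary: p h rule: less_induct)
  case less
  show ?case
  proof (cases "distinct p")
    case True
    have ce: "cycle_edges p = set (walk_edges (h # p))"
      using cycle_edges_eq_walk_edges[of p] less.prems(1,2) by simp
    have "length p \<noteq> 1"
    proof
      assume "length p = 1"
      then obtain x where "p = [x]" by (auto simp: length_Suc_conv)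
      then show False using less.prems assms(2) by auto
    qed
    moreover have "length p \<noteq> 2"
    proof
      assume "length p = 2"
      then obtain x y where "p = [x, y]" by (auto simp: length_Suc_conv numeral_2_eq_2)
      then have "col ` set (walk_edges (h # p)) = {col {x, y}}"
        using less.prems by (auto simp: insert_commute)
      \<comment> \<open>A single edge walked back and forth has one colour, but more than (1 -
        \<epsilon>) * 2 \<ge> 1 are required.\<close>
      then show False using less.prems assms(1) \<open>length p = 2\<close> by simp
    qed
    ultimately have "3 \<le> length p" using less.prems by (cases p) (auto simp: neq_Nil_conv)
    moreover have "set p \<subseteq> V"
    proof
      fix x assume "x \<in> set p"
      then obtain i where "i < length p" "p ! i = x" by (auto simp: in_set_conv_nth)
      then have "{x, p ! (Suc i mod length p)} \<in> cycle_edges p" unfolding cycle_edges_def by blast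
      then have "{x, p ! (Suc i mod length p)} \<in> E" using ce less.prems(3) by auto
      then have "{x, p ! (Suc i mod length p)} \<subseteq> V" using assms(2) by auto
      then show "x \<in> V" by simp
    qed
    ultimately have "is_cycle V E p"
      using True ce less.prems by (simp add: is_cycle_def)
    then show ?thesis using ce less.prems by auto
  next
    case False
    then obtain a x b c where p: "p = a @ [x] @ b @ [x] @ c" using not_distinct_decomp by blast
    \<comment> \<open>\<open>x # q\<close> is the detour between two visits to \<open>x\<close>;
      \<open>h # s\<close> is the walk with this detour cut out, still closed at
      \<open>h\<close>.\<close>
    define q where "q = b @ [x]"
    define s where "s = a @ [x] @ c"
    have we: "walk_edges (h # p) = walk_edges (h # a @ [x]) @ walk_edges (x # q) @ walk_edges (x # c)"
      using walk_edges_append[of "h # a" x "b @ x # c"] walk_edges_append[of "x # b" x c]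
      by (simp add: p q_def)
    have ws: "walk_edges (h # s) = walk_edges (h # a @ [x]) @ walk_edges (x # c)"
      using walk_edges_append[of "h # a" x c] by (simp add: s_def)
    have "col ` set (walk_edges (h # p)) = col ` set (walk_edges (x # q)) \<union> col ` set (walk_edges (h # s))"
      unfolding we ws by auto
    then have "card (col ` set (walk_edges (h # p)))
        \<le> card (col ` set (walk_edges (x # q))) + card (col ` set (walk_edges (h # s)))"
      by (simp add: card_Un_le)
    moreover have len: "length p = length q + length s" by (simp add: p q_def s_def)
    ultimately have "(1 - \<epsilon>) * length q + (1 - \<epsilon>) * length s
        < card (col ` set (walk_edges (x # q))) + card (col ` set (walk_edges (h # s)))"
      using less.prems(4) by (simp add: algebra_simps)
    then consider "(1 - \<epsilon>) * length q < card (col ` set (walk_edges (x # q)))"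
      | "(1 - \<epsilon>) * length s < card (col ` set (walk_edges (h # s)))" by linarith
    then show ?thesis
    proof cases
      case 1
      show ?thesis
        by (rule less.hyps[of q x]) (use 1 len less.prems we in \<open>auto simp: q_def s_def\<close>)
    next
      case 2
      have "last s = h" using less.prems by (auto simp: p s_def split: if_splits)
      then show ?thesis
        by (intro less.hyps[of s h]) (use 2 len less.prems we ws in \<open>auto simp: q_def s_def\<close>)
    qed
  qed
qed

section \<open>Rainbow walks by the pedestrian argument\<close>

lemma finite_edges:
  assumes "finite V" "\<forall>e\<in>E. e \<subseteq> V \<and> card e = 2"
  shows "finite E"
  using assms by (meson Pow_iff finite_Pow_iff finite_subset subsetI)

text \<open>A pedestrian stands on every vertex; the colours are called out one after another, and both
  pedestrians at the ends of an edge of the current colour swap places. Here \<open>w v\<close> is the reversed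
  route of the pedestrian standing at \<open>v\<close> once the colours in \<open>C\<close> have been called.\<close>

lemma pedestrian_walks:
  assumes "finite V" and E: "\<forall>e\<in>E. e \<subseteq> V \<and> card e = 2" and proper: "proper_edge_colouring E col"
    and "finite C"
  shows "\<exists>w. (\<forall>v\<in>V. w v \<noteq> [] \<and> hd (w v) = v \<and> set (w v) \<subseteq> V \<and> set (walk_edges (w v)) \<subseteq> E
              \<and> col ` set (walk_edges (w v)) \<subseteq> C \<and> distinct (map col (walk_edges (w v))))
          \<and> (\<Sum>v\<in>V. length (walk_edges (w v))) = 2 * card {e\<in>E. col e \<in> C}"
  using \<open>finite C\<close>
proof (induction C)
  case empty
  show ?case by (rule exI[of _ "\<lambda>v. [v]"]) auto
next
  case (insert c C)
  then obtain w where w_all: "\<forall>v\<in>V. w v \<noteq> [] \<and> hd (w v) = v \<and> set (w v) \<subseteq> V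
        \<and> set (walk_edges (w v)) \<subseteq> E
        \<and> col ` set (walk_edges (w v)) \<subseteq> C \<and> distinct (map col (walk_edges (w v)))"
    and sw: "(\<Sum>v\<in>V. length (walk_edges (w v))) = 2 * card {e\<in>E. col e \<in> C}"
    by (elim exE conjE)
  note w = bspec[OF w_all]
  have fE: "finite E" using \<open>finite V\<close> E by (rule finite_edges)
  define M where "M = {e\<in>E. col e = c}"
  have MD: "e \<in> E" "col e = c" "e \<subseteq> V" "card e = 2" if "e \<in> M" for e
    using that E by (auto simp: M_def)
  \<comment> \<open>As the colouring is proper, the colour class \<open>M\<close> is a matching, and
    \<open>m\<close> is the involution exchanging the ends of its edges. The default value
    \<open>v\<close> fixes the vertices that \<open>M\<close> misses.\<close>
  define m where "m v = (if \<exists>u. {v, u} \<in> M then SOME u. {v, u} \<in> M else v)" for v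
  have dis: "e = f" if "e \<in> M" "f \<in> M" "e \<inter> f \<noteq> {}" for e f
    using that proper by (auto simp: M_def proper_edge_colouring_def)
  have mI: "m v = u" if "{v, u} \<in> M" for u v
  proof -
    have "{v, m v} \<in> M" unfolding m_def using that by (auto intro: someI)
    then have "{v, m v} = {v, u}" using dis that by blast
    then show ?thesis by (auto simp: doubleton_eq_iff)
  qed
  have mV: "m v \<in> V" if "v \<in> V" for v
  proof (cases "\<exists>u. {v, u} \<in> M")
    case True
    then show ?thesis using MD(3) mI by blast
  next
    case False
    then show ?thesis using that by (simp add: m_def)
  qed
  have mm: "m (m v) = v" for v
  proof (cases "\<exists>u. {v, u} \<in> M")
    case True
    then show ?thesis using mI by (metis insert_commute)
  next
    case False
    then have "m v = v" by (simp add: m_def)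
    then show ?thesis by simp
  qed
  have bij: "bij_betw m V V"
    by (rule bij_betw_byWitness[of V m m]) (use mV mm in auto)
  have M_iff: "v \<in> \<Union>M \<longleftrightarrow> {v, m v} \<in> M" for v
  proof
    assume "v \<in> \<Union>M"
    then obtain e where e: "e \<in> M" "v \<in> e" by blast
    then obtain u where "e = {v, u}" using MD(4)[OF e(1)]
      by (metis card_2_iff insert_commute insertE singletonD)
    then show "{v, m v} \<in> M" using e mI by auto
  qed auto
  \<comment> \<open>After the swap, the pedestrian at an end \<open>v\<close> of an edge of
    \<open>M\<close> is the one who stood at \<open>m v\<close>; routes being reversed, the new
    position goes in front.\<close>
  define w' where "w' v = (if v \<in> \<Union>M then v # w (m v) else w v)" for v
  have len: "length (walk_edges (w' v)) = length (walk_edges (w (m v))) + (if v \<in> \<Union>M then 1 else 0)"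
    if "v \<in> V" for v
  proof (cases "v \<in> \<Union>M")
    case True
    then show ?thesis using w[OF mV[OF that]] by (auto simp: w'_def Suc_diff_le)
  next
    case False
    then have "m v = v" by (auto simp: m_def)
    then show ?thesis using False by (simp add: w'_def)
  qed
  \<comment> \<open>Each edge of \<open>M\<close> lengthens exactly two routes by one step, which
    keeps the total at twice the number of edges called.\<close>
  have "(\<Sum>v\<in>V. length (walk_edges (w' v)))
      = (\<Sum>v\<in>V. length (walk_edges (w (m v)))) + (\<Sum>v\<in>V. if v \<in> \<Union>M then 1 else 0)"
    by (simp only: len sum.distrib cong: sum.cong)
  also have "(\<Sum>v\<in>V. length (walk_edges (w (m v)))) = 2 * card {e\<in>E. col e \<in> C}"
    unfolding sw[symmetric] by (rule sum.reindex_bij_betw[OF bij])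
  also have "(\<Sum>v\<in>V. if v \<in> \<Union>M then 1 else 0) = card (\<Union>M)"
  proof -
    have "V \<inter> {v. v \<in> \<Union>M} = \<Union>M" using MD(3) by auto
    then show ?thesis using \<open>finite V\<close> by (simp add: sum.If_cases)
  qed
  also have "card (\<Union>M) = 2 * card M"
  proof -
    have "card (\<Union>M) = (\<Sum>e\<in>M. card e)"
      using dis MD(4) by (intro card_Union_disjoint)
        (auto simp: pairwise_def disjnt_def intro: card_ge_0_finite)
    then show ?thesis using MD(4) by simp
  qed
  also have "2 * card {e\<in>E. col e \<in> C} + 2 * card M = 2 * card {e\<in>E. col e \<in> insert c C}"
  proof -
    have "{e\<in>E. col e \<in> insert c C} = {e\<in>E. col e \<in> C} \<union> M" by (auto simp: M_def)
    moreover have "card ({e\<in>E. col e \<in> C} \<union> M) = card {e\<in>E. col e \<in> C} + card M"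
      using fE insert.hyps by (intro card_Un_disjoint) (auto simp: M_def)
    ultimately show ?thesis by simp
  qed
  finally have sum': "(\<Sum>v\<in>V. length (walk_edges (w' v))) = 2 * card {e\<in>E. col e \<in> insert c C}"
    .
  have "w' v \<noteq> [] \<and> hd (w' v) = v \<and> set (w' v) \<subseteq> V \<and> set (walk_edges (w' v)) \<subseteq> E
        \<and> col ` set (walk_edges (w' v)) \<subseteq> insert c C \<and> distinct (map col (walk_edges (w' v)))"
    if "v \<in> V" for v
  proof (cases "v \<in> \<Union>M")
    case True
    note wm = w[OF mV[OF that]]
    have e: "{v, m v} \<in> M" using True M_iff by blast
    have "walk_edges (v # w (m v)) = {v, m v} # walk_edges (w (m v))"
      using wm by (cases "w (m v)") auto
    \<comment> \<open>Since \<open>c\<close> is not in \<open>C\<close>, the new first edge repeats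
      no colour of the route.\<close>
    then show ?thesis using True wm that MD(1,2)[OF e] insert.hyps by (auto simp: w'_def)
  next
    case False
    then show ?thesis using w[OF that] by (auto simp: w'_def)
  qed
  then show ?case using sum' by blast
qed

text \<open>Averaging: once all colours of \<open>E\<close> have been called, the routes of the
  \<open>card V\<close> pedestrians have total length \<open>2 * card E\<close>, so one of them is
  at least as long as the average degree.\<close>

lemma long_rainbow_walk:
  assumes "finite V" "V \<noteq> {}" and E: "\<forall>e\<in>E. e \<subseteq> V \<and> card e = 2"
    and proper: "proper_edge_colouring E col"
  obtains xs where "xs \<noteq> []" "set xs \<subseteq> V" "set (walk_edges xs) \<subseteq> E"
    "distinct (map col (walk_edges xs))" "2 * card E \<le> card V * length (walk_edges xs)"
proof -
  have fE: "finite E" using \<open>finite V\<close> E by (rule finite_edges)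
  obtain w where w: "\<And>v. v \<in> V \<Longrightarrow> w v \<noteq> [] \<and> set (w v) \<subseteq> V \<and> set (walk_edges (w v)) \<subseteq> E
        \<and> distinct (map col (walk_edges (w v)))"
    and sw: "(\<Sum>v\<in>V. length (walk_edges (w v))) = 2 * card {e\<in>E. col e \<in> col ` E}"
    using pedestrian_walks[OF assms(1) E proper finite_imageI[OF fE]] by meson
  have "\<exists>v\<in>V. 2 * card E \<le> card V * length (walk_edges (w v))"
  proof (rule ccontr)
    assume "\<not> ?thesis"
    then have "(\<Sum>v\<in>V. card V * length (walk_edges (w v))) < (\<Sum>v\<in>V. 2 * card E)"
      using assms(1,2) by (intro sum_strict_mono) auto
    moreover have "{e\<in>E. col e \<in> col ` E} = E" by auto
    ultimately show False using sw by (simp flip: sum_distrib_left)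
  qed
  then show thesis using that w by blast
qed

section \<open>Densest subgraphs\<close>

definition edges_in :: "'a set set \<Rightarrow> 'a set \<Rightarrow> 'a set set" where
  "edges_in E U = {e\<in>E. e \<subseteq> U}"

text \<open>Take \<open>U\<close> maximising the ratio \<rho> of edges to vertices. What remains
  after deleting \<open>W\<close> has ratio at most \<rho>, so the deletion must destroy at least
  \<rho> edges per vertex of \<open>W\<close>.\<close>

lemma densest_subset:
  fixes V :: "'a set"
  assumes "finite V" "V \<noteq> {}" "finite E" "{} \<notin> E"
  obtains U \<rho> where "U \<subseteq> V" "U \<noteq> {}" "real (card (edges_in E V)) \<le> \<rho> * real (card V)"
    "\<And>W. W \<subseteq> U \<Longrightarrow> \<rho> * real (card W) \<le> real (card {e \<in> edges_in E U. e \<inter> W \<noteq> {}})"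
proof -
  define d where "d U = real (card (edges_in E U)) / real (card U)" for U
  define A where "A = d ` (Pow V - {{}})"
  have A: "finite A" "A \<noteq> {}" using assms by (auto simp: A_def)
  have "Max A \<in> A" using A by (rule Max_in)
  then obtain U where "U \<in> Pow V - {{}}" "Max A = d U"
    unfolding A_def by (rule imageE)
  then have U: "U \<subseteq> V" "U \<noteq> {}" "d U = Max A" by auto
  have le: "real (card (edges_in E W)) \<le> d U * real (card W)" if "W \<subseteq> V" for W
  proof (cases "W = {}")
    case False
    then have "d W \<le> d U" using that A U by (auto simp: A_def)
    moreover have "card W > 0" using False that assms(1) by (meson card_gt_0_iff finite_subset)
    ultimately show ?thesis by (simp add: d_def[of W] divide_simps)
  next
    \<comment> \<open>The empty set occurs below as \<open>U - W\<close> when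
      \<open>W = U\<close>.\<close>
    case True
    then have "edges_in E W = {}" using assms(4) by (auto simp: edges_in_def)
    then show ?thesis using True by simp
  qed
  have fU: "finite U" using U assms(1) finite_subset by blast
  have "d U * real (card W) \<le> real (card {e \<in> edges_in E U. e \<inter> W \<noteq> {}})" if "W \<subseteq> U" for W
  proof -
    have "real (card (edges_in E U)) = d U * real (card U)"
      using U(2) fU unfolding d_def by simp
    moreover have "edges_in E U = edges_in E (U - W) \<union> {e \<in> edges_in E U. e \<inter> W \<noteq> {}}"
      by (auto simp: edges_in_def)
    then have "card (edges_in E U) \<le> card (edges_in E (U - W)) + card {e \<in> edges_in E U. e \<inter> W \<noteq> {}}"
      by (metis card_Un_le)
    moreover have "real (card (edges_in E (U - W))) \<le> d U * real (card (U - W))"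
      by (rule le) (use U in blast)
    moreover have "real (card (U - W)) = real (card U) - real (card W)"
      using that fU by (simp add: card_Diff_subset card_mono finite_subset of_nat_diff)
    ultimately show ?thesis by (simp add: algebra_simps)
  qed
  then show thesis using that[of U "d U"] U le by blast
qed

section \<open>Balls in the graph metric\<close>

fun gball :: "'a set set \<Rightarrow> 'a \<Rightarrow> nat \<Rightarrow> 'a set" where
  "gball E x 0 = {x}"
| "gball E x (Suc r) = gball E x r \<union> {y. \<exists>z\<in>gball E x r. {z, y} \<in> E}"

lemma gball_walk:
  assumes "y \<in> gball E x r"
  obtains p where "last (x # p) = y" "length p \<le> r" "set (walk_edges (x # p)) \<subseteq> E"
  using assms
proof (induction r arbitrary: y thesis)
  case 0
  then show ?case by (metis gball.simps(1) last.simps le_refl list.size(3) singletonD empty_subsetI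
        list.set(1) walk_edges.simps(2))
next
  case (Suc r)
  show ?case
  proof (cases "y \<in> gball E x r")
    case True
    then show ?thesis using Suc.IH Suc.prems(1) le_SucI by metis
  next
    case False
    then obtain z where z: "z \<in> gball E x r" "{z, y} \<in> E" using Suc.prems by auto
    obtain p where p: "last (x # p) = z" "length p \<le> r" "set (walk_edges (x # p)) \<subseteq> E"
      using Suc.IH[OF _ z(1)] by blast
    have "x # p = butlast (x # p) @ [z]" using p(1) by (metis append_butlast_last_id list.distinct(1))
    then have "walk_edges (x # p @ [y]) = walk_edges (x # p) @ [{z, y}]"
      using walk_edges_append[of "butlast (x # p)" z "[y]"]
      by (metis append.assoc append_Cons append_Nil walk_edges.simps(2,3))
    then show ?thesis using Suc.prems(1)[of "p @ [y]"] p z by auto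
  qed
qed

lemma gball_subset:
  assumes "x \<in> U" "\<forall>e\<in>E. e \<subseteq> U"
  shows "gball E x r \<subseteq> U"
proof (induction r)
  case (Suc r)
  have "y \<in> U" if "{z, y} \<in> E" for z y using bspec[OF assms(2) that] by simp
  then show ?case using Suc by auto
qed (use assms(1) in simp)

text \<open>The other end of the edge is a neighbour of a vertex in the ball. Thus the edges that
  \<open>densest_subset\<close> provides at a ball are all spanned by the ball of the next
  radius.\<close>

lemma edges_meeting_gball:
  assumes "e \<in> E" "card e = 2" "e \<inter> gball E x r \<noteq> {}"
  shows "e \<subseteq> gball E x (Suc r)"
proof -
  obtain z where z: "z \<in> e" "z \<in> gball E x r" using assms by blast
  then obtain y where "e = {z, y}" using assms(2) by (metis card_2_iff insert_commute insertE singletonD)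
  then show ?thesis using z assms(1) by auto
qed

text \<open>Perpetual doubling would give \<open>f r\<close> \<ge> \<open>2 ^ r\<close>, which is
  unbounded. Up to the least radius at which doubling fails this growth does hold, so
  \<open>2 ^ r\<close> \<le> \<open>f r\<close> \<le> \<open>n\<close> there, which makes
  \<open>r\<close> logarithmic in \<open>n\<close>.\<close>

lemma non_doubling_radius:
  fixes f :: "nat \<Rightarrow> nat"
  assumes "f 0 \<ge> 1" "\<And>r. f r \<le> n"
  obtains r where "f (Suc r) < 2 * f r" "2 ^ r \<le> n"
proof -
  have "\<exists>r. f (Suc r) < 2 * f r"
  proof (rule ccontr)
    assume "\<not> ?thesis"
    then have dbl: "2 * f r \<le> f (Suc r)" for r by (auto simp: not_less)
    have "2 ^ r \<le> f r" for r
    proof (induction r)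
      case (Suc r)
      then show ?case using dbl[of r] by simp
    qed (use assms in simp)
    then have "2 ^ n \<le> n" using assms(2) le_trans by blast
    then show False using less_exp[of n] by linarith
  qed
  then obtain r where r: "f (Suc r) < 2 * f r" "\<And>s. s < r \<Longrightarrow> \<not> f (Suc s) < 2 * f s"
    using exists_least_iff[of "\<lambda>r. f (Suc r) < 2 * f r"] by blast
  have "s \<le> r \<Longrightarrow> 2 ^ s \<le> f s" for s
  proof (induction s)
    case (Suc s)
    then show ?case using r(2)[of s] by simp
  qed (use assms in simp)
  then show thesis using that r assms(2) le_trans by blast
qed

section \<open>A rainbow walk closed up through the centre of a ball\<close>

lemma almost_rainbow_cycle:
  fixes V :: "'a set" and \<epsilon> :: real
  assumes n: "8 \<le> card V" and \<epsilon>: "0 < \<epsilon>" "\<epsilon> < 1/2"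
    and G: "finite_simple_graph V E" and proper: "proper_edge_colouring E col"
    and dense: "real (card E) \<ge> 4 / \<epsilon> * real (card V) * ln (real (card V))"
  shows "\<exists>p. is_cycle V E p \<and> real (card (col ` cycle_edges p)) > (1 - \<epsilon>) * real (length p)"
proof -
  let ?n = "card V"
  have fV: "finite V" and E: "\<forall>e\<in>E. e \<subseteq> V \<and> card e = 2"
    using G by (auto simp: finite_simple_graph_def)
  have "V \<noteq> {}" using n by auto
  have fE: "finite E" using fV E by (rule finite_edges)
  have "{} \<notin> E" using E by force
  have EV: "edges_in E V = E" using E by (auto simp: edges_in_def)
  obtain U \<rho> where U: "U \<subseteq> V" "U \<noteq> {}" and \<rho>: "real (card E) \<le> \<rho> * real ?n"
    and touch: "\<And>W. W \<subseteq> U \<Longrightarrow> \<rho> * real (card W) \<le> real (card {e \<in> edges_in E U. e \<inter> W \<noteq> {}})"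
    using densest_subset[OF fV \<open>V \<noteq> {}\<close> fE \<open>{} \<notin> E\<close>] unfolding EV by blast
  obtain x where x: "x \<in> U" using U by blast
  define F where "F = edges_in E U"
  define B where "B = gball F x"
  have F: "\<forall>e\<in>F. e \<in> E \<and> e \<subseteq> U \<and> card e = 2" using E by (auto simp: F_def edges_in_def)
  have BU: "B r \<subseteq> U" for r unfolding B_def using x F by (intro gball_subset) auto
  have fB: "finite (B r)" for r using BU U fV by (meson finite_subset)
  have "card (B r) \<le> ?n" for r using BU U fV by (meson card_mono subset_trans)
  moreover have "card (B 0) \<ge> 1" by (simp add: B_def)
  ultimately obtain r where r: "card (B (Suc r)) < 2 * card (B r)" "2 ^ r \<le> ?n"
    using non_doubling_radius[of "\<lambda>r. card (B r)"] by blast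
  let ?W = "B (Suc r)"
  define D where "D = edges_in F ?W"
  have D: "\<forall>e\<in>D. e \<subseteq> ?W \<and> card e = 2" "D \<subseteq> F" using F by (auto simp: D_def edges_in_def)
  have "D \<subseteq> E" using D F by blast
  then have fD: "finite D" using fE finite_subset by blast
  \<comment> \<open>The edges meeting \<open>B r\<close> number at least \<rho> times its size, and
    all of them are spanned by \<open>B (Suc r)\<close>.\<close>
  have "\<rho> * card (B r) \<le> real (card {e \<in> F. e \<inter> B r \<noteq> {}})" using touch[OF BU] by (simp add: F_def)
  also have "{e \<in> F. e \<inter> B r \<noteq> {}} \<subseteq> D"
    using edges_meeting_gball F by (fastforce simp: D_def edges_in_def B_def)
  then have "card {e \<in> F. e \<inter> B r \<noteq> {}} \<le> card D"
    by (rule card_mono[OF fD])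
  finally have cD: "\<rho> * real (card (B r)) \<le> real (card D)" by simp
  have xW: "x \<in> ?W"
  proof -
    have "x \<in> B s" for s by (induction s) (auto simp: B_def)
    then show ?thesis .
  qed
  have "proper_edge_colouring D col"
    using proper \<open>D \<subseteq> E\<close> unfolding proper_edge_colouring_def by blast
  then obtain xs where xs: "xs \<noteq> []" "set xs \<subseteq> ?W" "set (walk_edges xs) \<subseteq> D"
    "distinct (map col (walk_edges xs))" "2 * card D \<le> card ?W * length (walk_edges xs)"
    using long_rainbow_walk[OF fB _ D(1)] xW by blast
  define l where "l = length (walk_edges xs)"
  \<comment> \<open>This is where 8 comes from: ln 8 = 3 ln 2 \<ge> 2, and the 2 will pay for the
    two extra steps in the bound \<open>Suc r\<close> on each connecting walk.\<close>
  have lnn: "ln (real ?n) \<ge> 2"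
  proof -
    have "ln (8::real) = 3 * ln 2" using ln_realpow[of 2 3] by simp
    then have "ln (8::real) \<ge> 2" using ln2_ge_two_thirds by simp
    moreover have "ln (8::real) \<le> ln (real ?n)" using n by (subst ln_le_cancel_iff) auto
    ultimately show ?thesis by linarith
  qed
  have \<rho>4: "\<rho> \<ge> 4 / \<epsilon> * ln (real ?n)"
  proof -
    have "(4 / \<epsilon> * ln (real ?n)) * real ?n \<le> \<rho> * real ?n" using dense \<rho> by (simp add: mult_ac)
    moreover have "real ?n > 0" using n by simp
    ultimately show ?thesis by (rule mult_right_le_imp_le)
  qed
  have \<rho>0: "\<rho> > 0"
    using lnn \<epsilon> by (intro less_le_trans[OF _ \<rho>4]) auto
  \<comment> \<open>As \<open>B (Suc r)\<close> is less than twice as large as \<open>B r\<close>,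
    the average degree of \<open>D\<close> on it exceeds \<rho>, and the rainbow walk is at least as
    long as that average.\<close>
  have l\<rho>: "real l > \<rho>"
  proof -
    have Wpos: "real (card ?W) > 0" using fB xW by (auto simp: card_gt_0_iff)
    have "\<rho> * real (card ?W) < \<rho> * (2 * real (card (B r)))"
      using r \<rho>0 by (intro mult_strict_left_mono) linarith+
    also have "\<dots> \<le> 2 * real (card D)" using cD by simp
    also have "\<dots> \<le> real (card ?W) * real l"
      using xs(5) unfolding l_def by (metis of_nat_le_iff of_nat_mult of_nat_numeral)
    finally show ?thesis using Wpos by (simp add: mult.commute)
  qed
  have "hd xs \<in> ?W" "last xs \<in> ?W" using xs by auto
  then obtain p q where p: "last (x # p) = hd xs" "length p \<le> Suc r" "set (walk_edges (x # p)) \<subseteq> F"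
    and q: "last (x # q) = last xs" "length q \<le> Suc r" "set (walk_edges (x # q)) \<subseteq> F"
    unfolding B_def by (metis gball_walk)
  \<comment> \<open>From \<open>x\<close> along \<open>p\<close> to the start of \<open>xs\<close>,
    along \<open>xs\<close>, and back to \<open>x\<close> along the reverse of \<open>q\<close>.
    Each \<open>tl\<close> drops a junction vertex that already ends the preceding piece.\<close>
  define z where "z = p @ tl xs @ tl (rev (x # q))"
  \<comment> \<open>These equations expose the junctions \<open>hd xs\<close> and
    \<open>last xs\<close>, at which \<open>walk_edges_append\<close> can cut.\<close>
  have e1: "x # p = butlast (x # p) @ [hd xs]"
    using p(1) by (metis append_butlast_last_id list.distinct(1))
  have e2: "xs = butlast xs @ [last xs]" "xs = hd xs # tl xs" using xs(1) by auto
  have e3: "rev (x # q) = last xs # tl (rev (x # q))"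
    using q(1) by (metis hd_rev list.collapse list.distinct(1) rev_is_Nil_conv)
  have mid: "xs @ tl (rev (x # q)) = butlast xs @ rev (x # q)"
    by (subst e3, subst e2(1)) simp
  have "x # z = (x # p) @ tl xs @ tl (rev (x # q))" by (simp add: z_def)
  also have "\<dots> = butlast (x # p) @ (hd xs # tl xs) @ tl (rev (x # q))"
    by (subst e1) simp
  also have "hd xs # tl xs = xs" using e2 by simp
  finally have xz: "x # z = butlast (x # p) @ xs @ tl (rev (x # q))" .
  also have "\<dots> = butlast (x # p) @ hd xs # tl xs @ tl (rev (x # q))"
    using xs(1) by simp
  finally have "walk_edges (x # z)
      = walk_edges (x # p) @ walk_edges (hd xs # tl xs @ tl (rev (x # q)))"
    using e1 walk_edges_append by metis
  also have "hd xs # tl xs @ tl (rev (x # q)) = butlast xs @ last xs # tl (rev (x # q))"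
    by (simp only: mid e2(2)[symmetric] e3[symmetric] append_Cons[symmetric])
  also have "walk_edges \<dots> = walk_edges xs @ walk_edges (rev (x # q))"
    using e2(1) e3 walk_edges_append by metis
  finally have wz: "walk_edges (x # z) = walk_edges (x # p) @ walk_edges xs @ walk_edges (rev (x # q))" .
  have zE: "set (walk_edges (x # z)) \<subseteq> E"
    unfolding wz using p(3) q(3) xs(3) D(2) F set_walk_edges_rev[of "x # q"] by auto
  have lz: "length z = length p + l + length q"
    using arg_cong[OF wz, of length] by (simp add: l_def)
  have "real l > 0" using l\<rho> \<rho>0 by linarith
  then have "z \<noteq> []" using lz by auto
  have "last z = x"
  proof -
    have "last (x # z) = last (rev (x # q))"
      unfolding xz mid by simp
    then show ?thesis using \<open>z \<noteq> []\<close> by (simp add: last_rev)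
  qed
  have "real l \<le> real (card (col ` set (walk_edges (x # z))))"
  proof -
    have "l = card (col ` set (walk_edges xs))"
      using distinct_card[OF xs(4)] by (simp add: l_def)
    also have "\<dots> \<le> card (col ` set (walk_edges (x # z)))"
      unfolding wz by (intro card_mono) auto
    finally show ?thesis by simp
  qed
  \<comment> \<open>The constant 4 is 3 + 1: from ln 2 \<ge> 2/3, the \<open>2 * r\<close> steps
    cost at most 3 ln n, and the remaining 2 at most ln n. So the connections total at most 4 ln n
    \<le> \<epsilon> * \<rho> < \<epsilon> * l.\<close>
  moreover have "(1 - \<epsilon>) * real (length z) < real l"
  proof -
    have "real r * ln 2 = ln (2 ^ r)" by (simp add: ln_realpow)
    also have "\<dots> \<le> ln (real ?n)"
      using of_nat_mono[OF r(2), where 'a = real] n by (subst ln_le_cancel_iff) auto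
    finally have "real r * (2/3) \<le> ln (real ?n)"
      using mult_left_mono[OF ln2_ge_two_thirds, of "real r"] by linarith
    then have "2 * real r \<le> 3 * ln (real ?n)" by simp
    then have "2 * real r + 2 \<le> 4 * ln (real ?n)" using lnn by simp
    also have "\<dots> \<le> \<epsilon> * \<rho>" using \<rho>4 \<epsilon> by (simp add: field_simps)
    also have "\<dots> < \<epsilon> * real l" using l\<rho> \<epsilon> by simp
    finally have "real (length p + length q) < \<epsilon> * real l" using p(2) q(2) by linarith
    moreover have "(1 - \<epsilon>) * real (length p + length q) \<le> real (length p + length q)"
      using \<epsilon> by (intro mult_left_le_one_le) auto
    ultimately show ?thesis unfolding lz by (simp add: algebra_simps)
  qed
  ultimately show ?thesis
    using colourful_closed_walk_imp_cycle[OF _ E \<open>last z = x\<close> \<open>z \<noteq> []\<close> zE, of \<epsilon> col] \<epsilon> by simp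
qed

theorem theorem1p9:
  shows "\<exists>n0::nat. \<forall>n\<ge>n0. \<forall>\<epsilon>::real. 0 < \<epsilon> \<and> \<epsilon> < 1/2 \<longrightarrow>
    (\<forall>(V :: 'a set) (E :: 'a set set) (col :: 'a set \<Rightarrow> 'c).
       finite_simple_graph V E \<and> card V = n \<and> proper_edge_colouring E col \<and>
       real (card E) \<ge> 4 / \<epsilon> * real n * ln (real n) \<longrightarrow>
       (\<exists>k p. is_cycle V E p \<and> length p = k \<and>
              real (card (col ` cycle_edges p)) > (1 - \<epsilon>) * real k))"
proof (rule exI[of _ 8], intro allI impI, elim conjE)
  fix n :: nat and \<epsilon> :: real and V :: "'a set" and E :: "'a set set" and col :: "'a set \<Rightarrow> 'c"
  assume "8 \<le> n" "0 < \<epsilon>" "\<epsilon> < 1/2" "finite_simple_graph V E" "card V = n"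
    "proper_edge_colouring E col" "4 / \<epsilon> * real n * ln (real n) \<le> real (card E)"
  then obtain p where "is_cycle V E p"
    "real (card (col ` cycle_edges p)) > (1 - \<epsilon>) * real (length p)"
    using almost_rainbow_cycle[of V \<epsilon> E col] by auto
  then show "\<exists>k p. is_cycle V E p \<and> length p = k \<and>
      real (card (col ` cycle_edges p)) > (1 - \<epsilon>) * real k"
    by (intro exI conjI) (rule refl | assumption)+
qed

end
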